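(* Let $R$ be a tree and let $G$ be a graph. The following statements are equivalent: (1) $G$ is an $R$-covered subtree overlap graph; (2) $G$ is the complement of an $R$-cochordal-mixed graph; (3) $G$ is a bushy $R$-covered subtree overlap graph.
   Context: Graphs are finite and simple. Subtrees of a tree are given as sets of vertices inducing subtrees; collections of subtrees are multisets. Two sets $A,B$ overlap if $A\cap B\ne\emptyset$, $A\not\subseteq B$ and $B\not\subseteq A$. The overlap (resp. disjointness) graph of a multiset $\{S_1,\dots,S_n\}$ of nonempty sets has vertices $v_1,\dots,v_n$ with $v_iv_j$ an edge iff $S_i,S_j$ overlap (resp. are disjoint). A subtree overlap representation of $G$ is a multiset of subtrees of a host tree $T$ whose overlap graph is $G$. For a multiset $\mathcal{T}$ of subtrees of a tree $T$, a subtree $t$ of $T$ is a covering subtree of $\mathcal{T}$ if it intersects every member of $\mathcal{T}$. A vertex $v$ of a subtree $t$ of $T$ is bushy (with respect to $t$ in $T$) if every neighbour of $v$ not in $t$ is a leaf of $T$; $t$ is bushy in $T$ if all its vertices are bushy. $G$ is an $R$-covered subtree overlap graph if it has a subtree overlap representation with a covering subtree isomorphic to $R$; it is a bushy $R$-covered subtree overlap graph if it has a subtree overlap representation with a bushy covering subtree isomorphic to $R$. A graph is $R$-cochordal if it is the disjointness graph of a multiset of subtrees of a host tree isomorphic to $R$. A graph $H=(V,E)$ is $R$-cochordal-mixed if there is a partition of $E$ into $E_1,E_2$ such that $(V,E_1)$ is $R$-cochordal and there is a transitive orientation $\overrightarrow{E_2}$ of $(V,E_2)$ such that for every three distinct vertices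 $u,v,w$, if $(u\to v)\in\overrightarrow{E_2}$ and $vw\in E_1$ then $uw\in E_1$. *)

theory Defs
  imports "Graph_Theory.Graph_Theory"
begin

text \<open>
  A finite simple graph is a symmetric loopfree finite digraph: the locales \<open>graph\<close> and, for
  arcs given as pairs of vertices, \<open>pair_graph\<close>. An undirected edge is its pair of opposite arcs.
\<close>

text \<open>
  The library constant \<open>tree\<close> excludes directed cycles, hence every graph with an edge, since two
  opposite arcs form a cycle of length 2. In a simple graph the undirected cycles are the
  directed cycles of length at least 3.
\<close>
definition is_tree :: "('a, 'b) pre_digraph \<Rightarrow> bool" where
  "is_tree T \<longleftrightarrow> graph T \<and> connected T \<and> \<not> (\<exists>p. pre_digraph.cycle T p \<and> 3 \<le> length p)"

definition subtree :: "'t pair_pre_digraph \<Rightarrow> 't set \<Rightarrow> bool" where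
  "subtree T s \<longleftrightarrow> s \<subseteq> pverts T \<and> is_tree (with_proj T \<restriction> s)"

definition leaf :: "'t pair_pre_digraph \<Rightarrow> 't \<Rightarrow> bool" where
  "leaf T v \<longleftrightarrow> v \<in> pverts T \<and> out_degree (with_proj T) v = 1"

definition complement :: "'a pair_pre_digraph \<Rightarrow> 'a pair_pre_digraph" where
  "complement G = \<lparr> pverts = pverts G,
     parcs = {(u, v). u \<in> pverts G \<and> v \<in> pverts G \<and> u \<noteq> v \<and> (u, v) \<notin> parcs G} \<rparr>"

definition overlap :: "'t set \<Rightarrow> 't set \<Rightarrow> bool" where
  "overlap A B \<longleftrightarrow> A \<inter> B \<noteq> {} \<and> \<not> A \<subseteq> B \<and> \<not> B \<subseteq> A"

text \<open>
  A multiset of sets whose members are labelled by the vertices in \<open>V\<close> is a family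
  \<open>S\<close> indexed by \<open>V\<close>; it need not be injective.
\<close>
definition overlap_graph :: "'a set \<Rightarrow> ('a \<Rightarrow> 't set) \<Rightarrow> 'a pair_pre_digraph" where
  "overlap_graph V S = \<lparr> pverts = V,
     parcs = {(u, v). u \<in> V \<and> v \<in> V \<and> u \<noteq> v \<and> overlap (S u) (S v)} \<rparr>"

definition disjointness_graph :: "'a set \<Rightarrow> ('a \<Rightarrow> 't set) \<Rightarrow> 'a pair_pre_digraph" where
  "disjointness_graph V S = \<lparr> pverts = V,
     parcs = {(u, v). u \<in> V \<and> v \<in> V \<and> u \<noteq> v \<and> S u \<inter> S v = {}} \<rparr>"

definition subtree_overlap_representation ::
    "'a pair_pre_digraph \<Rightarrow> 't pair_pre_digraph \<Rightarrow> ('a \<Rightarrow> 't set) \<Rightarrow> bool" where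
  "subtree_overlap_representation G T S \<longleftrightarrow>
     is_tree (with_proj T) \<and> (\<forall>v \<in> pverts G. subtree T (S v)) \<and> G = overlap_graph (pverts G) S"

definition covering_subtree ::
    "'t pair_pre_digraph \<Rightarrow> 'a set \<Rightarrow> ('a \<Rightarrow> 't set) \<Rightarrow> 't set \<Rightarrow> bool" where
  "covering_subtree T V S t \<longleftrightarrow> subtree T t \<and> (\<forall>v \<in> V. t \<inter> S v \<noteq> {})"

definition bushy_vertex :: "'t pair_pre_digraph \<Rightarrow> 't set \<Rightarrow> 't \<Rightarrow> bool" where
  "bushy_vertex T t v \<longleftrightarrow> (\<forall>w. (v, w) \<in> parcs T \<and> w \<notin> t \<longrightarrow> leaf T w)"

definition bushy :: "'t pair_pre_digraph \<Rightarrow> 't set \<Rightarrow> bool" where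
  "bushy T t \<longleftrightarrow> (\<forall>v \<in> t. bushy_vertex T t v)"

text \<open>
  In the following definitions the host tree has natural numbers as vertices. As host trees are
  finite, every one of them is isomorphic to a tree of this kind.
\<close>
definition covered_subtree_overlap_graph ::
    "'r pair_pre_digraph \<Rightarrow> 'a pair_pre_digraph \<Rightarrow> bool" where
  "covered_subtree_overlap_graph R G \<longleftrightarrow>
     (\<exists>(T :: nat pair_pre_digraph) S t.
        subtree_overlap_representation G T S \<and> covering_subtree T (pverts G) S t \<and>
        digraph_iso (with_proj T \<restriction> t) (with_proj R))"

definition bushy_covered_subtree_overlap_graph ::
    "'r pair_pre_digraph \<Rightarrow> 'a pair_pre_digraph \<Rightarrow> bool" where
  "bushy_covered_subtree_overlap_graph R G \<longleftrightarrow>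
     (\<exists>(T :: nat pair_pre_digraph) S t.
        subtree_overlap_representation G T S \<and> covering_subtree T (pverts G) S t \<and>
        bushy T t \<and> digraph_iso (with_proj T \<restriction> t) (with_proj R))"

definition cochordal :: "'r pair_pre_digraph \<Rightarrow> 'a pair_pre_digraph \<Rightarrow> bool" where
  "cochordal R G \<longleftrightarrow>
     (\<exists>(T :: nat pair_pre_digraph) S.
        is_tree (with_proj T) \<and> digraph_iso (with_proj T) (with_proj R) \<and>
        (\<forall>v \<in> pverts G. subtree T (S v)) \<and> G = disjointness_graph (pverts G) S)"

definition transitive_orientation :: "'a pair_pre_digraph \<Rightarrow> 'a rel \<Rightarrow> bool" where
  "transitive_orientation G D \<longleftrightarrow> D \<union> D\<inverse> = parcs G \<and> D \<inter> D\<inverse> = {} \<and> trans D"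

text \<open>
  The parts \<open>E1\<close> and \<open>E2\<close> may be empty; symmetry makes them sets of undirected edges.
\<close>
definition cochordal_mixed :: "'r pair_pre_digraph \<Rightarrow> 'a pair_pre_digraph \<Rightarrow> bool" where
  "cochordal_mixed R H \<longleftrightarrow>
     (\<exists>E1 E2. sym E1 \<and> sym E2 \<and> E1 \<union> E2 = parcs H \<and> E1 \<inter> E2 = {} \<and>
        cochordal R \<lparr> pverts = pverts H, parcs = E1 \<rparr> \<and>
        (\<exists>D. transitive_orientation \<lparr> pverts = pverts H, parcs = E2 \<rparr> D \<and>
          (\<forall>u v w. distinct [u, v, w] \<and> (u, v) \<in> D \<and> (v, w) \<in> E1 \<longrightarrow> (u, w) \<in> E1)))"

end

theory Submission
  imports Defs
begin

text \<open>
  If a subtree \<open>t\<close> meets all \<open>S v\<close>, then by the Helly property two members are disjoint iff their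
  traces on \<open>t\<close> are. So the non-edges of an overlap graph split into disjoint pairs, represented
  on \<open>t\<close>, and nested pairs, oriented by inclusion. Conversely, given subtrees of \<open>R\<close> and a
  transitive orientation, replace \<open>S v\<close> by the union of all \<open>S u\<close> with \<open>u = v\<close> or \<open>u \<rightarrow> v\<close>: the
  mixed condition says that no disjoint pair is lost. Hang a new leaf for each \<open>u\<close> on the
  enlarged subtree of \<open>u\<close>, and add it to the subtree of \<open>v\<close> for every \<open>v\<close> with \<open>u = v\<close> or
  \<open>u \<rightarrow> v\<close>. Then the inclusions are exactly the orientation, and \<open>R\<close> is a bushy cover.
\<close>

section \<open>Connected sets and trees grown by leaves\<close>

text \<open>For symmetric \<open>E\<close> this is connectedness of the graph induced on
  \<open>C\<close>, stated through closed subsets so that no walks occur. Only arcs within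
  \<open>C\<close> count, so one relation serves for all subsets of a host tree.\<close>

definition conn :: "'t rel \<Rightarrow> 't set \<Rightarrow> bool" where
  "conn E C \<longleftrightarrow> C \<noteq> {} \<and>
     (\<forall>A. A \<subseteq> C \<and> A \<noteq> {} \<and> (\<forall>x\<in>A. \<forall>y\<in>C. (x, y) \<in> E \<longrightarrow> y \<in> A) \<longrightarrow> A = C)"

text \<open>Trees as an inductive predicate, so that facts about them follow by removing the leaf
  attached last. Each edge enters as its two opposite arcs.\<close>

inductive leaf_tree :: "'t set \<Rightarrow> 't rel \<Rightarrow> bool" where
  single: "leaf_tree {x} {}"
| attach: "leaf_tree V E \<Longrightarrow> y \<in> V \<Longrightarrow> x \<notin> V \<Longrightarrow> leaf_tree (insert x V) (insert (x, y) (insert (y, x) E))"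

lemma connI:
  assumes "C \<noteq> {}"
    and "\<And>A x. \<lbrakk>A \<subseteq> C; A \<noteq> {}; \<And>x y. \<lbrakk>x \<in> A; y \<in> C; (x, y) \<in> E\<rbrakk> \<Longrightarrow> y \<in> A; x \<in> C\<rbrakk> \<Longrightarrow> x \<in> A"
  shows "conn E C"
  using assms unfolding conn_def by blast

lemma connD:
  assumes "conn E C" "A \<subseteq> C" "A \<noteq> {}" "\<And>x y. \<lbrakk>x \<in> A; y \<in> C; (x, y) \<in> E\<rbrakk> \<Longrightarrow> y \<in> A"
  shows "A = C"
  using assms unfolding conn_def by blast

lemma conn_nonempty: "conn E C \<Longrightarrow> C \<noteq> {}"
  by (simp add: conn_def)

lemma conn_cong:
  assumes "\<And>x y. \<lbrakk>x \<in> C; y \<in> C\<rbrakk> \<Longrightarrow> (x, y) \<in> E \<longleftrightarrow> (x, y) \<in> F"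
  shows "conn E C \<longleftrightarrow> conn F C"
  unfolding conn_def using assms by (metis subsetD)

lemma conn_single: "conn E {x}"
  unfolding conn_def by blast

text \<open>A closed subset of the union meets \<open>C\<close>, because every vertex of
  \<open>X\<close> has an arc into \<open>C\<close>; so it contains \<open>C\<close>, and the
  opposite arcs then give all of \<open>X\<close>.\<close>

lemma conn_attach:
  assumes "conn E C" "\<And>x. x \<in> X \<Longrightarrow> \<exists>y\<in>C. (x, y) \<in> E \<and> (y, x) \<in> E"
  shows "conn E (C \<union> X)"
proof (rule connI)
  show "C \<union> X \<noteq> {}" using assms(1) by (simp add: conn_def)
next
  fix A z assume A: "A \<subseteq> C \<union> X" "A \<noteq> {}" and z: "z \<in> C \<union> X"
    and cl: "\<And>x y. \<lbrakk>x \<in> A; y \<in> C \<union> X; (x, y) \<in> E\<rbrakk> \<Longrightarrow> y \<in> A"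
  have "A \<inter> C \<noteq> {}" using A cl assms(2) by blast
  then have "A \<inter> C = C" using cl by (intro connD[OF assms(1)]) auto
  then show "z \<in> A" using z cl assms(2) by blast
qed

text \<open>A closed subset that meets some \<open>X i\<close> contains it, hence meets and contains
  \<open>C\<close>, hence meets and contains every other \<open>X i\<close>.\<close>

lemma conn_UN:
  assumes "conn E C" "\<And>i. i \<in> I \<Longrightarrow> conn E (X i)" "\<And>i. i \<in> I \<Longrightarrow> X i \<inter> C \<noteq> {}"
  shows "conn E (C \<union> (\<Union>i\<in>I. X i))"
proof (rule connI)
  show "C \<union> (\<Union>i\<in>I. X i) \<noteq> {}" using assms(1) by (simp add: conn_def)
next
  fix A z assume A: "A \<subseteq> C \<union> (\<Union>i\<in>I. X i)" "A \<noteq> {}" and z: "z \<in> C \<union> (\<Union>i\<in>I. X i)"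
    and cl: "\<And>x y. \<lbrakk>x \<in> A; y \<in> C \<union> (\<Union>i\<in>I. X i); (x, y) \<in> E\<rbrakk> \<Longrightarrow> y \<in> A"
  have X: "X i \<subseteq> A" if "i \<in> I" "A \<inter> X i \<noteq> {}" for i
  proof -
    have "A \<inter> X i = X i" using that cl by (intro connD[OF assms(2)[OF that(1)]]) auto
    then show ?thesis by blast
  qed
  have "A \<inter> C \<noteq> {}" using A X assms(3) by blast
  then have "A \<inter> C = C" using cl by (intro connD[OF assms(1)]) auto
  then show "z \<in> A" using z X assms(3) by blast
qed

text \<open>Otherwise \<open>{x}\<close> would be a proper closed subset of
  \<open>C\<close>.\<close>

lemma conn_leaf_neighbour:
  assumes "conn E C" "x \<in> C" "C \<noteq> {x}" "\<And>z. (x, z) \<in> E \<Longrightarrow> z = y"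
  shows "y \<in> C"
  using connD[OF assms(1), of "{x}"] assms by blast

text \<open>Let \<open>A\<close> be closed in \<open>C - {x}\<close>. If \<open>y\<close> is in
  \<open>A\<close>, then \<open>insert x A\<close> is closed in \<open>C\<close>; if not, no arc
  leads from \<open>A\<close> to \<open>x\<close>, so \<open>A\<close> itself is closed in
  \<open>C\<close>.\<close>

lemma conn_remove_leaf:
  assumes "conn E C" "C \<noteq> {x}" "x \<in> C" "\<And>z. (x, z) \<in> E \<Longrightarrow> z = y" "\<And>z. (z, x) \<in> E \<Longrightarrow> z = y"
  shows "conn E (C - {x})"
proof (rule connI)
  show "C - {x} \<noteq> {}" using assms by blast
next
  fix A z assume A: "A \<subseteq> C - {x}" "A \<noteq> {}" and z: "z \<in> C - {x}"
    and cl: "\<And>u v. \<lbrakk>u \<in> A; v \<in> C - {x}; (u, v) \<in> E\<rbrakk> \<Longrightarrow> v \<in> A"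
  show "z \<in> A"
  proof (cases "y \<in> A")
    case True
    have "insert x A = C" 
      using A assms(3) True cl assms(4) by (intro connD[OF assms(1)]) auto
    then show ?thesis using z by blast
  next
    case False
    have "A = C" using A cl False assms(5) by (intro connD[OF assms(1)]) auto
    then show ?thesis using z by blast
  qed
qed

section \<open>Connected vertex sets inside a tree grown by leaves\<close>

lemma leaf_tree_basic:
  assumes "leaf_tree V E"
  shows "finite V \<and> E \<subseteq> V \<times> V \<and> sym E \<and> irrefl E \<and> conn E V"
  using assms
proof induction
  case (single x)
  then show ?case by (auto simp: sym_def irrefl_def conn_single)
next
  case (attach V E y x)
  let ?E = "insert (x, y) (insert (y, x) E)"
  have "conn ?E V"
    using attach conn_cong[of V E ?E] by auto
  then have "conn ?E (V \<union> {x})"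
    by (rule conn_attach) (use attach in auto)
  then show ?case
    using attach by (auto simp: sym_def irrefl_def)
qed

lemma conn_attach_arc_iff:
  assumes "x \<notin> C"
  shows "conn (insert (x, y) (insert (y, x) E)) C \<longleftrightarrow> conn E C"
  by (rule conn_cong) (use assms in auto)

text \<open>The reduction behind the three inductions below: a connected set other than
  \<open>{x}\<close> passes to the smaller tree, and the neighbour \<open>y\<close> stands in for a
  deleted \<open>x\<close>.\<close>

lemma conn_remove_attached:
  assumes "leaf_tree V E" "y \<in> V" "x \<notin> V" "C \<subseteq> insert x V"
    "conn (insert (x, y) (insert (y, x) E)) C" "C \<noteq> {x}"
  shows "conn E (C - {x})" "C - {x} \<subseteq> V" "x \<in> C \<Longrightarrow> y \<in> C - {x}"
proof -
  let ?E = "insert (x, y) (insert (y, x) E)"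
  have nb: "z = y" if "(x, z) \<in> ?E \<or> (z, x) \<in> ?E" for z
    using that leaf_tree_basic[OF assms(1)] assms(2,3) by blast
  have "conn ?E (C - {x})"
  proof (cases "x \<in> C")
    case True
    show ?thesis by (rule conn_remove_leaf[OF assms(5,6) True]) (use nb in blast)+
  next
    case False
    then show ?thesis using assms(5) by simp
  qed
  then show "conn E (C - {x})" using conn_attach_arc_iff[of x "C - {x}" y E] by blast
  show "C - {x} \<subseteq> V" using assms(4) by blast
  show "y \<in> C - {x}" if "x \<in> C"
  proof -
    have "y \<in> C" by (rule conn_leaf_neighbour[OF assms(5) that assms(6)]) (use nb in blast)
    then show ?thesis using assms(2,3) by blast
  qed
qed

text \<open>Delete the last leaf, apply the induction hypothesis to the rest of \<open>C\<close>,
  and if the leaf was in \<open>C\<close>, attach it again at \<open>y\<close>, which is then in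
  \<open>C\<close> too.\<close>

lemma leaf_tree_conn_subset:
  assumes "leaf_tree V E" "C \<subseteq> V" "conn E C"
  shows "leaf_tree C (E \<inter> C \<times> C)"
  using assms
proof (induction arbitrary: C)
  case (single x)
  then have "C = {x}" by (auto simp: conn_def)
  then show ?case using leaf_tree.single by simp
next
  case (attach V E y x)
  let ?E = "insert (x, y) (insert (y, x) E)"
  have E: "E \<subseteq> V \<times> V" using leaf_tree_basic[OF attach(1)] by blast
  show ?case
  proof (cases "C = {x}")
    case True
    then have "?E \<inter> C \<times> C = {}" using E attach(2,3) by blast
    then show ?thesis using True leaf_tree.single by simp
  next
    case False
    note C = conn_remove_attached[OF attach(1-3,5,6) False]
    have IH: "leaf_tree (C - {x}) (E \<inter> (C - {x}) \<times> (C - {x}))" using attach.IH C by blast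
    show ?thesis
    proof (cases "x \<in> C")
      case True
      have "leaf_tree (insert x (C - {x})) (insert (x, y) (insert (y, x) (E \<inter> (C - {x}) \<times> (C - {x}))))"
        using C(3)[OF True] by (intro leaf_tree.attach[OF IH]) auto
      moreover have "insert x (C - {x}) = C" using True by blast
      moreover have "insert (x, y) (insert (y, x) (E \<inter> (C - {x}) \<times> (C - {x}))) = ?E \<inter> C \<times> C"
        using True C(3) E attach(3) by blast
      ultimately show ?thesis by simp
    next
      case False
      then have "E \<inter> (C - {x}) \<times> (C - {x}) = ?E \<inter> C \<times> C" "C - {x} = C" by blast+
      then show ?thesis using IH by simp
    qed
  qed
qed

lemma leaf_tree_conn_inter:
  assumes "leaf_tree V E" "A \<subseteq> V" "conn E A" "B \<subseteq> V" "conn E B" "A \<inter> B \<noteq> {}"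
  shows "conn E (A \<inter> B)"
  using assms
proof (induction arbitrary: A B)
  case (single x)
  then have "A \<inter> B = {x}" by auto
  then show ?case by (simp add: conn_single)
next
  case (attach V E y x)
  let ?E = "insert (x, y) (insert (y, x) E)"
  show ?case
  proof (cases "A = {x} \<or> B = {x}")
    case True
    then have "A \<inter> B = {x}" using attach.prems by auto
    then show ?thesis by (simp add: conn_single)
  next
    case False
    then have ne: "A \<noteq> {x}" "B \<noteq> {x}" by auto
    note A = conn_remove_attached[OF attach(1-3,5,6) ne(1)]
    note B = conn_remove_attached[OF attach(1-3,7,8) ne(2)]
    let ?I = "(A - {x}) \<inter> (B - {x})"
    \<comment> \<open>If \<open>x\<close> is a common vertex, then so is \<open>y\<close>, and the
      intersection stays nonempty.\<close>
    have "?I \<noteq> {}" using attach.prems A(3) B(3) by blast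
    then have "conn E ?I" using attach.IH A B by blast
    then have I: "conn ?E ?I" using conn_attach_arc_iff[of x ?I y E] by blast
    show ?thesis
    proof (cases "x \<in> A \<inter> B")
      case True
      then have "conn ?E (?I \<union> {x})" using A(3) B(3) by (intro conn_attach[OF I]) blast
      moreover have "?I \<union> {x} = A \<inter> B" using True by blast
      ultimately show ?thesis by simp
    next
      case False
      then have "?I = A \<inter> B" by blast
      then show ?thesis using I by simp
    qed
  qed
qed

text \<open>Two sets sharing the last leaf \<open>x\<close> also share \<open>y\<close>, unless one
  of them is \<open>{x}\<close>; so pairwise intersections survive the deletion of \<open>x\<close>.
  If one set is \<open>{x}\<close>, the other two contain \<open>x\<close>.\<close>

lemma leaf_tree_helly:
  assumes "leaf_tree V E" "A \<subseteq> V" "conn E A" "B \<subseteq> V" "conn E B" "C \<subseteq> V" "conn E C"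
    "A \<inter> B \<noteq> {}" "B \<inter> C \<noteq> {}" "A \<inter> C \<noteq> {}"
  shows "A \<inter> B \<inter> C \<noteq> {}"
  using assms
proof (induction arbitrary: A B C)
  case (single x)
  then show ?case by auto
next
  case (attach V E y x)
  show ?case
  proof (cases "A = {x} \<or> B = {x} \<or> C = {x}")
    case True
    then show ?thesis using attach.prems by blast
  next
    case False
    then have ne: "A \<noteq> {x}" "B \<noteq> {x}" "C \<noteq> {x}" by auto
    note A = conn_remove_attached[OF attach(1-3,5,6) ne(1)]
    note B = conn_remove_attached[OF attach(1-3,7,8) ne(2)]
    note C = conn_remove_attached[OF attach(1-3,9,10) ne(3)]
    have "(A - {x}) \<inter> (B - {x}) \<noteq> {}" "(B - {x}) \<inter> (C - {x}) \<noteq> {}" "(A - {x}) \<inter> (C - {x}) \<noteq> {}"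
      using attach.prems A(3) B(3) C(3) by blast+
    then have "(A - {x}) \<inter> (B - {x}) \<inter> (C - {x}) \<noteq> {}" using attach.IH A(1,2) B(1,2) C(1,2) by blast
    then show ?thesis by blast
  qed
qed

section \<open>Acyclic connected graphs are grown by leaves\<close>

text \<open>Cycles as cyclic sequences of arcs, successors being taken modulo the length. Distinct
  heads express that no vertex repeats, whichever arc is listed first.\<close>

definition cyc :: "'t rel \<Rightarrow> ('t \<times> 't) list \<Rightarrow> bool" where
  "cyc E p \<longleftrightarrow> set p \<subseteq> E \<and> 3 \<le> length p \<and> distinct (map snd p) \<and>
     (\<forall>i < length p. snd (p ! i) = fst (p ! (Suc i mod length p)))"

lemma pcas_nth:
  assumes "pcas u p v" "p \<noteq> []"
  shows "fst (p ! 0) = u \<and> snd (p ! (length p - 1)) = v \<and>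
    (\<forall>i. Suc i < length p \<longrightarrow> snd (p ! i) = fst (p ! Suc i))"
  using assms
proof (induction p arbitrary: u)
  case (Cons e p)
  show ?case
  proof (cases "p = []")
    case False
    then have IH: "fst (p ! 0) = snd e" "snd (p ! (length p - 1)) = v"
      "\<And>i. Suc i < length p \<Longrightarrow> snd (p ! i) = fst (p ! Suc i)"
      using Cons.IH[of "snd e"] Cons.prems by auto
    have "snd ((e # p) ! i) = fst ((e # p) ! Suc i)" if "Suc i < length (e # p)" for i
      using that IH by (cases i) auto
    then show ?thesis using Cons.prems IH False by (auto simp: nth_Cons')
  qed (use Cons in auto)
qed simp

lemma pawalk_verts_tl:
  "pcas u p v \<Longrightarrow> tl (pawalk_verts u p) = map snd p"
proof (induction p arbitrary: u)
  case (Cons e p)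
  then have "tl (pawalk_verts (snd e) p) = map snd p" by auto
  moreover have "hd (pawalk_verts (snd e) p) = snd e" "pawalk_verts (snd e) p \<noteq> []"
    using Cons.prems by (cases p; auto)+
  ultimately show ?case by (cases "pawalk_verts (snd e) p") auto
qed simp

lemma cycle_cyc:
  assumes "pre_digraph.cycle (with_proj T) p" "3 \<le> length p"
  shows "cyc (parcs T) p"
proof -
  from assms(1) obtain u where p: "set p \<subseteq> parcs T" "pcas u p u" "p \<noteq> []"
    "distinct (tl (pawalk_verts u p))"
    by (auto simp: pre_digraph.cycle_def pre_digraph.awalk_def cas_with_proj_eq awalk_verts_with_proj_eq)
  note n = pcas_nth[OF p(2,3)]
  have "snd (p ! i) = fst (p ! (Suc i mod length p))" if "i < length p" for i
  proof (cases "Suc i = length p")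
    \<comment> \<open>The last arc ends at \<open>u\<close>, where the first one starts.\<close>
    case True
    then have "i = length p - 1" by simp
    then show ?thesis using n True by simp
  next
    case False
    then show ?thesis using n that by simp
  qed
  then show ?thesis using p assms(2) pawalk_verts_tl[OF p(2)] by (auto simp: cyc_def)
qed

text \<open>An arc with head \<open>x\<close> starts at \<open>y\<close>, so the arc before it has
  head \<open>y\<close>; the arc after it starts at \<open>x\<close>, so it has head
  \<open>y\<close> as well. Distinct heads make these two arcs equal, which is impossible for at
  least three arcs.\<close>

lemma cyc_avoids_leaf:
  assumes "cyc E p" "\<And>z. (x, z) \<in> E \<Longrightarrow> z = y" "\<And>z. (z, x) \<in> E \<Longrightarrow> z = y" "e \<in> set p"
  shows "fst e \<noteq> x \<and> snd e \<noteq> x"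
proof -
  let ?n = "length p"
  have p: "set p \<subseteq> E" "3 \<le> ?n" "distinct (map snd p)"
    and st: "\<And>i. i < ?n \<Longrightarrow> snd (p ! i) = fst (p ! (Suc i mod ?n))"
    using assms(1) by (auto simp: cyc_def)
  have pos: "0 < ?n" using p(2) by linarith
  have pred: "\<exists>j<?n. Suc j mod ?n = k" if "k < ?n" for k
  proof (cases k)
    case 0
    then show ?thesis using pos by (intro exI[of _ "?n - 1"]) auto
  next
    case (Suc j)
    then show ?thesis using that by (intro exI[of _ j]) auto
  qed
  have no_snd: "snd (p ! k) \<noteq> x" if k: "k < ?n" for k
  proof
    assume x: "snd (p ! k) = x"
    obtain j where j: "j < ?n" "Suc j mod ?n = k" using pred[OF k] by blast
    let ?l = "Suc k mod ?n"
    have l: "?l < ?n" using pos by simp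
    have "(fst (p ! k), x) \<in> E" using p(1) nth_mem[OF k] x by (metis prod.collapse subsetD)
    then have "fst (p ! k) = y" by (rule assms(3))
    then have 1: "snd (p ! j) = y" using st[OF j(1)] j(2) by simp
    have "fst (p ! ?l) = x" using st[OF k] x by simp
    then have "(x, snd (p ! ?l)) \<in> E" using p(1) nth_mem[OF l] by (metis prod.collapse subsetD)
    then have "snd (p ! ?l) = y" by (rule assms(2))
    then have "j = ?l" using 1 p(3) j(1) l by (simp add: distinct_conv_nth) metis
    then have "j = Suc (Suc j) mod ?n" using j(2) by (metis mod_Suc_eq)
    \<comment> \<open>As \<open>j < ?n\<close>, the modulus is subtracted at most once, and
      \<open>j = j + 2 - ?n\<close> would force length 2.\<close>
    moreover have "Suc (Suc j) mod ?n = (if Suc (Suc j) < ?n then Suc (Suc j) else Suc (Suc j) - ?n)"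
      using j(1) p(2) by (auto simp: mod_if)
    ultimately show False using p(2) j(1) by (auto split: if_splits)
  qed
  obtain k where k: "k < ?n" "e = p ! k" using assms(4) by (metis in_set_conv_nth)
  \<comment> \<open>Every tail is the head of the preceding arc, so excluding \<open>x\<close> as a
    head is enough.\<close>
  obtain j where "j < ?n" "Suc j mod ?n = k" using pred[OF k(1)] by blast
  then show ?thesis using no_snd st k by metis
qed

text \<open>A cycle avoids the last leaf and so already lies in the smaller tree.\<close>

lemma leaf_tree_acyclic:
  assumes "leaf_tree V E"
  shows "\<not> cyc E p"
  using assms
proof (induction arbitrary: p)
  case (single x)
  then show ?case by (auto simp: cyc_def)
next
  case (attach V E y x)
  let ?E = "insert (x, y) (insert (y, x) E)"
  have E: "E \<subseteq> V \<times> V" using leaf_tree_basic[OF attach(1)] by blast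
  show ?case
  proof
    assume c: "cyc ?E p"
    have "fst e \<noteq> x \<and> snd e \<noteq> x" if "e \<in> set p" for e
      by (rule cyc_avoids_leaf[OF c _ _ that, of x y]) (use E attach(2,3) in auto)
    then have "set p \<subseteq> E" using c by (fastforce simp: cyc_def)
    then have "cyc E p" using c by (simp add: cyc_def)
    then show False using attach.IH by blast
  qed
qed

section \<open>Translation between library trees and trees grown by leaves\<close>

lemma graph_with_proj_iff:
  "graph (with_proj T) \<longleftrightarrow> finite (pverts T) \<and> parcs T \<subseteq> pverts T \<times> pverts T \<and> sym (parcs T) \<and> irrefl (parcs T)"
    (is "?L \<longleftrightarrow> ?R")
proof
  assume ?L
  then interpret pair_graph T by (rule pair_graphI_graph)
  show ?R
    using pair_finite_verts pair_sym_arcs pair_no_loops wellformed'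
    by (fastforce simp: symmetric_def irrefl_def)
next
  assume R: ?R
  then have "finite (parcs T)" by (meson finite_SigmaI finite_subset)
  then have "pair_graph T" using R
    by unfold_locales (auto simp: symmetric_def irrefl_def)
  then show ?L by (rule pair_graph.pair_graphD_graph)
qed

text \<open>A closed set contains all that is reachable from it, and the set of vertices reachable
  from a given vertex is closed.\<close>

lemma connected_iff_conn:
  assumes "graph (with_proj T)"
  shows "connected (with_proj T) \<longleftrightarrow> conn (parcs T) (pverts T)"
proof -
  have E: "parcs T \<subseteq> pverts T \<times> pverts T" "sym (parcs T)"
    using assms graph_with_proj_iff by blast+
  \<comment> \<open>Library connectedness is strong connectedness of the symmetric closure, which
    changes nothing here.\<close>
  have "mk_symmetric (with_proj T) = T"
    using E(2) by (cases T) (auto simp: mk_symmetric_def sym_def)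
  then have "connected (with_proj T) \<longleftrightarrow> strongly_connected (with_proj T)"
    by (simp add: connected_def)
  also have "\<dots> \<longleftrightarrow> conn (parcs T) (pverts T)"
  proof
    assume s: "strongly_connected (with_proj T)"
    show "conn (parcs T) (pverts T)"
    proof (rule connI)
      show "pverts T \<noteq> {}" using s by (auto simp: strongly_connected_def)
    next
      fix A v assume A: "A \<subseteq> pverts T" "A \<noteq> {}" and v: "v \<in> pverts T"
        and cl: "\<And>x y. \<lbrakk>x \<in> A; y \<in> pverts T; (x, y) \<in> parcs T\<rbrakk> \<Longrightarrow> y \<in> A"
      obtain u where u: "u \<in> A" using A by blast
      then have "reachable (with_proj T) u v" using s A v by (auto simp: strongly_connected_def)
      then have "(u, v) \<in> (parcs T)\<^sup>*" using reachable_rtranclI by force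
      then show "v \<in> A"
        by induction (use u cl E in auto)
    qed
  next
    assume c: "conn (parcs T) (pverts T)"
    interpret graph "with_proj T" by (rule assms)
    have "reachable (with_proj T) u v" if uv: "u \<in> pverts T" "v \<in> pverts T" for u v
    proof -
      let ?A = "{w. reachable (with_proj T) u w}"
      have "?A = pverts T"
      proof (rule connD[OF c])
        show "?A \<subseteq> pverts T" using reachable_in_verts by force
        show "?A \<noteq> {}" using uv reachable_refl by force
        show "y \<in> ?A" if "x \<in> ?A" "y \<in> pverts T" "(x, y) \<in> parcs T" for x y
          using that reachable_adj_trans by force
      qed
      then show ?thesis using uv by blast
    qed
    then show "strongly_connected (with_proj T)"
      using c by (auto simp: strongly_connected_def conn_def)
  qed
  finally show ?thesis .
qed

lemma leaf_tree_is_tree: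
  assumes "leaf_tree (pverts T) (parcs T)"
  shows "is_tree (with_proj T)"
proof -
  have "graph (with_proj T)" using leaf_tree_basic[OF assms] graph_with_proj_iff by blast
  then show ?thesis
    using connected_iff_conn leaf_tree_basic[OF assms] leaf_tree_acyclic[OF assms] cycle_cyc
    by (auto simp: is_tree_def)
qed

text \<open>A maximal subset grown by attaching leaves is everything: the next vertex has only one
  neighbour in it, as two neighbours would close a cycle through a path inside the set.\<close>
lemma is_tree_leaf_tree:
  assumes "is_tree (with_proj T)"
  shows "leaf_tree (pverts T) (parcs T)"
proof -
  let ?V = "pverts T" and ?E = "parcs T"
  have g: "graph (with_proj T)" and acyc: "\<And>p. pre_digraph.cycle (with_proj T) p \<Longrightarrow> \<not> 3 \<le> length p"
    and c: "conn ?E ?V"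
    using assms connected_iff_conn by (auto simp: is_tree_def)
  have E: "finite ?V" "?E \<subseteq> ?V \<times> ?V" "sym ?E" "irrefl ?E" using g graph_with_proj_iff by blast+
  let ?P = "\<lambda>s. s \<subseteq> ?V \<and> leaf_tree s (?E \<inter> s \<times> s)"
  obtain r where r: "r \<in> ?V" using c by (auto simp: conn_def)
  have "?E \<inter> {r} \<times> {r} = {}" using E(4) by (auto simp: irrefl_def)
  then have "?P {r}" using r leaf_tree.single by auto
  \<comment> \<open>The bound on cardinalities yields a largest \<open>s\<close> with
    \<open>?P s\<close>.\<close>
  moreover have "\<forall>s. ?P s \<longrightarrow> card s < Suc (card ?V)"
    using E(1) card_mono by (auto simp: less_Suc_eq_le)
  ultimately have "\<exists>s. ?P s \<and> (\<forall>s'. ?P s' \<longrightarrow> card s' \<le> card s)"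
    by (rule Lattices_Big.ex_has_greatest_nat)
  then obtain s where s: "?P s" and max: "\<And>s'. ?P s' \<Longrightarrow> card s' \<le> card s"
    by metis
  have "s = ?V"
  proof (rule ccontr)
    assume ne: "s \<noteq> ?V"
    have b: "finite s" "conn (?E \<inter> s \<times> s) s" using s leaf_tree_basic by blast+
    \<comment> \<open>A proper nonempty \<open>s\<close> is not closed in the connected set
      \<open>?V\<close>, so some arc leaves it.\<close>
    obtain x y where xy: "y \<in> s" "x \<in> ?V" "(y, x) \<in> ?E" "x \<notin> s"
      using connD[OF c, of s] s ne conn_nonempty[OF b(2)] by blast
    have uniq: "z = y" if z: "z \<in> s" "(z, x) \<in> ?E" for z
    proof (rule ccontr)
      assume zy: "z \<noteq> y"
      let ?S = "\<lparr>pverts = s, parcs = ?E \<inter> s \<times> s\<rparr>"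
      have gS: "graph (with_proj ?S)"
        using leaf_tree_basic[OF s[THEN conjunct2]] graph_with_proj_iff[of ?S] by simp
      have cS: "connected (with_proj ?S)" using connected_iff_conn[OF gS] b(2) by simp
      interpret S: pair_graph ?S using gS by (rule pair_graphI_graph)
      have "mk_symmetric (with_proj ?S) = ?S"
        using E(3) by (auto simp: mk_symmetric_def sym_def)
      then have "reachable (with_proj ?S) y z"
        using cS z xy by (auto simp: connected_def strongly_connected_def)
      then obtain p where p: "S.apath y p z" using S.reachable_apath by blast
      then have p': "set p \<subseteq> ?E \<inter> s \<times> s" "pcas y p z" "distinct (pawalk_verts y p)"
        "set (pawalk_verts y p) \<subseteq> s"
        using S.awalk_conv[of y p z] by (auto simp: S.apath_def)
      have pn: "p \<noteq> []" using p'(2) zy by auto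
      \<comment> \<open>The cycle runs from \<open>x\<close> to \<open>y\<close>, along
        \<open>p\<close> inside \<open>s\<close> to \<open>z\<close>, and back to \<open>x\<close>;
        it has at least three arcs because \<open>p\<close> is nonempty.\<close>
      let ?c = "(x, y) # p @ [(z, x)]"
      have cas: "pcas a (q @ [(z, x)]) x \<longleftrightarrow> pcas a q z" for a q
        by (induction q arbitrary: a) auto
      have vs: "pawalk_verts a (q @ [(z, x)]) = pawalk_verts a q @ [x]" if "pcas a q z" for a q
        using that by (induction q arbitrary: a) auto
      have "pre_digraph.cycle (with_proj T) ?c"
        unfolding pre_digraph.cycle_def pre_digraph.awalk_def cas_with_proj_eq awalk_verts_with_proj_eq
        using p' xy z E(3) cas vs by (intro exI[of _ x]) (auto simp: sym_def)
      moreover have "3 \<le> length ?c" using pn by (cases p) auto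
      ultimately show False using acyc by blast
    qed
    have "leaf_tree (insert x s) (insert (x, y) (insert (y, x) (?E \<inter> s \<times> s)))"
      using s xy by (intro leaf_tree.attach) auto
    moreover have "insert (x, y) (insert (y, x) (?E \<inter> s \<times> s)) = ?E \<inter> insert x s \<times> insert x s"
    proof -
      have "(z, x) \<in> ?E \<longleftrightarrow> z = y" "(x, z) \<in> ?E \<longleftrightarrow> z = y" if "z \<in> s" for z
        using xy uniq[OF that] symD[OF E(3), of x z] symD[OF E(3), of y x] by blast+
      moreover have "(x, x) \<notin> ?E" using E(4) by (simp add: irrefl_def)
      ultimately show ?thesis using xy(1) by blast
    qed
    ultimately have "?P (insert x s)" using s xy by auto
    then have "card (insert x s) \<le> card s" by (rule max)
    then show False using xy b(1) by simp
  qed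
  moreover have "?E \<inter> ?V \<times> ?V = ?E" using E(2) by auto
  ultimately show ?thesis using s by simp
qed

lemma restrict_with_proj:
  "with_proj T \<restriction> s = with_proj \<lparr>pverts = s, parcs = parcs T \<inter> s \<times> s\<rparr>"
  by (auto simp: induce_subgraph_def with_proj_def)

text \<open>Acyclicity needs no check, since a connected subset of a tree grown by leaves is again
  grown by leaves. The remaining arguments can work with \<open>conn\<close> alone.\<close>

lemma subtree_iff:
  assumes "leaf_tree (pverts T) (parcs T)"
  shows "subtree T s \<longleftrightarrow> s \<subseteq> pverts T \<and> conn (parcs T) s"
proof -
  let ?S = "\<lparr>pverts = s, parcs = parcs T \<inter> s \<times> s\<rparr>"
  have c: "conn (parcs T \<inter> s \<times> s) s \<longleftrightarrow> conn (parcs T) s" by (rule conn_cong) auto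
  have "is_tree (with_proj ?S) \<longleftrightarrow> conn (parcs T) s" if s: "s \<subseteq> pverts T"
  proof
    assume "is_tree (with_proj ?S)"
    then have "leaf_tree s (parcs T \<inter> s \<times> s)" using is_tree_leaf_tree by fastforce
    then show "conn (parcs T) s" using leaf_tree_basic c by blast
  next
    assume "conn (parcs T) s"
    then have "leaf_tree (pverts ?S) (parcs ?S)" using leaf_tree_conn_subset[OF assms s] by simp
    then show "is_tree (with_proj ?S)" by (rule leaf_tree_is_tree)
  qed
  then show ?thesis by (auto simp: subtree_def restrict_with_proj)
qed

section \<open>Overlap representations and mixed graphs\<close>

lemma complement_complement:
  assumes "pair_graph G"
  shows "complement (complement G) = G"
proof -
  interpret pair_graph G by (rule assms)
  show ?thesis
    using wellformed' pair_no_loops by (cases G) (fastforce simp: complement_def)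
qed

lemma pair_graph_complement:
  assumes "pair_graph G"
  shows "pair_graph (complement G)"
proof -
  interpret G: pair_graph G by (rule assms)
  have "graph (with_proj (complement G))"
    using G.pair_finite_verts G.pair_sym_arcs
    by (auto simp: graph_with_proj_iff complement_def symmetric_def sym_def irrefl_def)
  then show ?thesis by (rule pair_graphI_graph)
qed

section \<open>From a covering subtree to a mixed graph\<close>

lemma covered_imp_cochordal_mixed:
  assumes "pair_graph G" "covered_subtree_overlap_graph R G"
  shows "cochordal_mixed R (complement G)"
proof -
  from assms(2) obtain T :: "nat pair_pre_digraph" and S t
    where rep: "subtree_overlap_representation G T S" and cov: "covering_subtree T (pverts G) S t"
      and iso: "digraph_iso (with_proj T \<restriction> t) (with_proj R)"
    unfolding covered_subtree_overlap_graph_def by blast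
  let ?V = "pverts G" and ?E = "parcs T"
  interpret G: pair_graph G by (rule assms(1))
  have T: "leaf_tree (pverts T) ?E" and G: "G = overlap_graph ?V S"
    using rep is_tree_leaf_tree by (auto simp: subtree_overlap_representation_def)
  have S: "S v \<subseteq> pverts T" "conn ?E (S v)" if "v \<in> ?V" for v
    using rep that subtree_iff[OF T] by (auto simp: subtree_overlap_representation_def)
  have t: "t \<subseteq> pverts T" "conn ?E t" and tS: "\<And>v. v \<in> ?V \<Longrightarrow> t \<inter> S v \<noteq> {}"
    using cov subtree_iff[OF T] by (auto simp: covering_subtree_def)
  let ?t = "\<lparr>pverts = t, parcs = ?E \<inter> t \<times> t\<rparr>"
  have t_tree: "leaf_tree (pverts ?t) (parcs ?t)" using leaf_tree_conn_subset[OF T t] by simp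
  define E1 where "E1 = {(u, v). u \<in> ?V \<and> v \<in> ?V \<and> u \<noteq> v \<and> S u \<inter> S v = {}}"
  define E2 where "E2 = {(u, v). u \<in> ?V \<and> v \<in> ?V \<and> u \<noteq> v \<and> (S u \<subseteq> S v \<or> S v \<subseteq> S u)}"
  obtain f :: "'a \<Rightarrow> nat" where f: "inj_on f ?V"
    using finite_imp_inj_to_nat_seg[OF G.pair_finite_verts] by blast
  \<comment> \<open>Equal sets include each other, yet each pair needs exactly one direction; the
    injection \<open>f\<close> breaks such ties. The order is lexicographic, hence
    transitive.\<close>
  define D where "D = {(u, v). u \<in> ?V \<and> v \<in> ?V \<and> (S u \<subset> S v \<or> S u = S v \<and> f u < f v)}"
  have ne: "S v \<noteq> {}" if "v \<in> ?V" for v using tS[OF that] by blast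
  have parcs: "E1 \<union> E2 = parcs (complement G)"
    by (subst G) (auto simp: E1_def E2_def complement_def overlap_graph_def overlap_def)
  \<comment> \<open>Helly for \<open>S u\<close>, \<open>S v\<close> and \<open>t\<close>: members
    that meet also meet within \<open>t\<close>.\<close>
  have meet: "S u \<inter> S v = {} \<longleftrightarrow> S u \<inter> t \<inter> (S v \<inter> t) = {}" if "u \<in> ?V" "v \<in> ?V" for u v
    using leaf_tree_helly[OF T S(1,2)[OF that(1)] S(1,2)[OF that(2)] t] tS that by blast
  have "conn (?E \<inter> t \<times> t) (S v \<inter> t)" if "v \<in> ?V" for v
  proof -
    have "conn ?E (S v \<inter> t)"
      using leaf_tree_conn_inter[OF T S(1,2)[OF that] t] tS[OF that] by blast
    then show ?thesis by (subst conn_cong[of _ _ ?E]) auto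
  qed
  then have "\<forall>v\<in>?V. subtree ?t (S v \<inter> t)" using subtree_iff[OF t_tree] by simp
  moreover have "is_tree (with_proj ?t)" using t_tree by (rule leaf_tree_is_tree)
  moreover have "digraph_iso (with_proj ?t) (with_proj R)" using iso by (simp add: restrict_with_proj)
  moreover have "disjointness_graph ?V (\<lambda>v. S v \<inter> t) = \<lparr>pverts = ?V, parcs = E1\<rparr>"
    using meet by (auto simp: disjointness_graph_def E1_def)
  ultimately have "cochordal R \<lparr>pverts = ?V, parcs = E1\<rparr>"
    unfolding cochordal_def
    by (intro exI[of _ ?t] exI[of _ "\<lambda>v. S v \<inter> t"]) simp
  moreover have "transitive_orientation \<lparr>pverts = ?V, parcs = E2\<rparr> D"
  proof -
    have "(u, v) \<in> D \<or> (v, u) \<in> D \<longleftrightarrow> (u, v) \<in> E2" for u v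
    proof (cases "u \<in> ?V \<and> v \<in> ?V \<and> u \<noteq> v")
      case True
      then have "f u < f v \<or> f v < f u" using inj_onD[OF f] nat_neq_iff by metis
      then show ?thesis using True unfolding D_def E2_def by blast
    next
      case False
      then show ?thesis unfolding D_def E2_def by blast
    qed
    then have "D \<union> D\<inverse> = E2" by auto
    moreover have "D \<inter> D\<inverse> = {}" by (auto simp: D_def)
    moreover have "trans D" unfolding trans_def D_def by fastforce
    ultimately show ?thesis by (simp add: transitive_orientation_def)
  qed
  moreover have "\<forall>u v w. distinct [u, v, w] \<and> (u, v) \<in> D \<and> (v, w) \<in> E1 \<longrightarrow> (u, w) \<in> E1"
    by (auto simp: D_def E1_def)
  moreover have "sym E1" "sym E2" by (auto simp: sym_def E1_def E2_def)
  \<comment> \<open>A pair both nested and disjoint would have an empty member, but all members meet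
    \<open>t\<close>.\<close>
  moreover have "E1 \<inter> E2 = {}" using ne by (fastforce simp: E1_def E2_def)
  moreover have "pverts (complement G) = ?V" by (simp add: complement_def)
  ultimately show ?thesis
    unfolding cochordal_mixed_def using parcs by (intro exI[of _ E1] exI[of _ E2]) auto
qed

section \<open>From a mixed graph to a bushy covering subtree\<close>

lemma leaf_tree_attach_leaves:
  assumes "leaf_tree V E" "finite W" "inj_on l W" "l ` W \<inter> V = {}" "\<And>w. w \<in> W \<Longrightarrow> a w \<in> V"
  shows "leaf_tree (V \<union> l ` W) (E \<union> (\<Union>w\<in>W. {(l w, a w), (a w, l w)}))"
  using assms(2-5)
proof (induction W)
  case empty
  then show ?case using assms(1) by simp
next
  case (insert w W)
  have "leaf_tree (insert (l w) (V \<union> l ` W)) (insert (l w, a w) (insert (a w, l w)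
      (E \<union> (\<Union>w\<in>W. {(l w, a w), (a w, l w)}))))"
    using insert by (intro leaf_tree.attach) auto
  then show ?case by (simp add: insert_commute)
qed

text \<open>The host tree \<open>T0\<close> of the cochordal part becomes the covering subtree. The
  leaves hung on it destroy those inclusions among the sets \<open>C v\<close> that \<open>D\<close>
  does not prescribe.\<close>

lemma cochordal_mixed_imp_bushy:
  assumes "pair_graph H" "cochordal_mixed R H"
  shows "bushy_covered_subtree_overlap_graph R (complement H)"
proof -
  let ?V = "pverts H"
  interpret H: pair_graph H by (rule assms(1))
  from assms(2) obtain E1 E2 D where E: "sym E1" "sym E2" "E1 \<union> E2 = parcs H" "E1 \<inter> E2 = {}"
    and coch: "cochordal R \<lparr>pverts = ?V, parcs = E1\<rparr>"
    and or: "transitive_orientation \<lparr>pverts = ?V, parcs = E2\<rparr> D"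
    and mix: "\<And>u v w. \<lbrakk>distinct [u, v, w]; (u, v) \<in> D; (v, w) \<in> E1\<rbrakk> \<Longrightarrow> (u, w) \<in> E1"
    unfolding cochordal_mixed_def by blast
  have D: "D \<union> D\<inverse> = E2" "D \<inter> D\<inverse> = {}" "trans D" using or by (auto simp: transitive_orientation_def)
  have EV: "u \<in> ?V" "v \<in> ?V" "u \<noteq> v" if "(u, v) \<in> parcs H" for u v
    using that H.wellformed' H.pair_no_loops[OF that] by auto
  have DV: "u \<in> ?V" "v \<in> ?V" "u \<noteq> v" "(u, v) \<notin> E1" "(v, u) \<notin> E1" "(v, u) \<notin> D" if "(u, v) \<in> D" for u v
    using that D(1,2) E EV[of u v] by (auto simp: sym_def)
  from coch obtain T0 :: "nat pair_pre_digraph" and S where T0: "is_tree (with_proj T0)"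
    and iso: "digraph_iso (with_proj T0) (with_proj R)"
    and S0: "\<forall>v\<in>?V. subtree T0 (S v)"
    and E1: "\<lparr>pverts = ?V, parcs = E1\<rparr> = disjointness_graph ?V S"
    unfolding cochordal_def by auto
  have E1_iff: "(u, v) \<in> E1 \<longleftrightarrow> u \<noteq> v \<and> S u \<inter> S v = {}" if "u \<in> ?V" "v \<in> ?V" for u v
    using E1 that by (auto simp: disjointness_graph_def)
  let ?W = "pverts T0" and ?F = "parcs T0"
  have lt0: "leaf_tree ?W ?F" using T0 by (rule is_tree_leaf_tree)
  have b0: "finite ?W" "?F \<subseteq> ?W \<times> ?W" "conn ?F ?W" using leaf_tree_basic[OF lt0] by blast+
  have S: "S v \<subseteq> ?W" "conn ?F (S v)" if "v \<in> ?V" for v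
    using S0 that subtree_iff[OF lt0] by auto

  \<comment> \<open>The down-set of \<open>v\<close> in the reflexive closure of
    \<open>D\<close>.\<close>
  define below where "below v = insert v {u. (u, v) \<in> D}" for v
  have below_V: "below v \<subseteq> ?V" if "v \<in> ?V" for v using that DV by (auto simp: below_def)
  have below_mono: "below u \<subseteq> below v" if "u \<in> below v" for u v
    using that D(3) by (auto simp: below_def dest: transD)
  define C where "C v = (\<Union>u\<in>below v. S u)" for v
  have C_sub: "C v \<subseteq> ?W" if "v \<in> ?V" for v using that S(1) below_V by (fastforce simp: C_def)
  have C_conn: "conn ?F (C v)" if v: "v \<in> ?V" for v
  proof -
    \<comment> \<open>A pair in \<open>D\<close> is not in \<open>E1\<close>, so its two sets meet;
      every part of the union thus meets \<open>S v\<close>.\<close>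
    have "S u \<inter> S v \<noteq> {}" if "(u, v) \<in> D" for u
      using that DV[of u v] E1_iff[of u v] v by blast
    then have "conn ?F (S v \<union> (\<Union>u\<in>{u. (u, v) \<in> D}. S u))"
      using S(2) DV v by (intro conn_UN) auto
    then show ?thesis by (simp add: C_def below_def)
  qed
  have C_mono: "C u \<subseteq> C v" if "u \<in> below v" for u v
    using below_mono[OF that] by (auto simp: C_def)
  \<comment> \<open>The mixed condition, extended to \<open>u = v\<close>; \<open>u = w\<close>
    cannot occur, as no pair is in both \<open>E1\<close> and \<open>E2\<close>.\<close>
  have down: "(u, w) \<in> E1" if "(v, w) \<in> E1" "u \<in> below v" for u v w
    using that mix[of u v w] DV[of u v] EV[of v w] E(3) by (cases "u = w") (auto simp: below_def)
  have disj: "C u \<inter> C v = {}" if uv: "(u, v) \<in> E1" for u v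
  proof -
    have "S x \<inter> S y = {}" if xy: "x \<in> below u" "y \<in> below v" for x y
    proof -
      have "(y, x) \<in> E1" using down[OF _ xy(2)] down[OF uv xy(1)] E(1) by (auto simp: sym_def)
      then show ?thesis using E1_iff[of y x] EV[of y x] E(3) by auto
    qed
    then show ?thesis unfolding C_def by blast
  qed

  obtain f :: "'a \<Rightarrow> nat" where f: "inj_on f ?V"
    using finite_imp_inj_to_nat_seg[OF H.pair_finite_verts] by blast
  \<comment> \<open>Fresh leaf names: all host vertices are less than \<open>N\<close>, and
    \<open>f\<close> keeps the names apart.\<close>
  obtain N where N: "\<And>x. x \<in> ?W \<Longrightarrow> x < N" using b0(1) by (auto simp: finite_nat_set_iff_bounded)
  define l where "l v = N + f v" for v
  have l: "inj_on l ?V" "l ` ?V \<inter> ?W = {}"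
    using f N by (fastforce simp: l_def inj_on_def)+
  \<comment> \<open>The leaf \<open>l v\<close> hangs on an arbitrarily chosen vertex of
    \<open>C v\<close>.\<close>
  define a where "a v = (SOME x. x \<in> C v)" for v
  have a: "a v \<in> C v" if "v \<in> ?V" for v
    using conn_nonempty[OF C_conn[OF that]] some_in_eq unfolding a_def by metis
  have aW: "a v \<in> ?W" if "v \<in> ?V" for v using a C_sub that by blast
  have lV0: "l v \<notin> ?W" if "v \<in> ?V" for v using l(2) that by blast
  have lC: "l u \<notin> C v" if "u \<in> ?V" "v \<in> ?V" for u v using lV0 C_sub that by blast

  define T where "T = \<lparr>pverts = ?W \<union> l ` ?V, parcs = ?F \<union> (\<Union>w\<in>?V. {(l w, a w), (a w, l w)})\<rparr>"
  have T: "leaf_tree (pverts T) (parcs T)"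
    unfolding T_def using lt0 H.pair_finite_verts l a C_sub
    by (simp only: pair_pre_digraph.simps, intro leaf_tree_attach_leaves) auto
  have T_V0: "(x, y) \<in> parcs T \<longleftrightarrow> (x, y) \<in> ?F" if "x \<in> ?W" "y \<in> ?W" for x y
    using that lV0 by (auto simp: T_def)
  \<comment> \<open>The leaf \<open>l u\<close> is a marker: \<open>S' v\<close> contains it exactly
    when \<open>u\<close> is in \<open>below v\<close>, so inclusions can be read off.\<close>
  define S' where "S' v = C v \<union> l ` below v" for v
  have l_S': "l u \<in> S' v \<longleftrightarrow> u \<in> below v" if "u \<in> ?V" "v \<in> ?V" for u v
    using lC[OF that] inj_on_image_mem_iff[OF l(1) that(1) below_V[OF that(2)]] by (simp add: S'_def)
  have sub': "S' u \<subseteq> S' v \<longleftrightarrow> u \<in> below v" if "u \<in> ?V" "v \<in> ?V" for u v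
  proof
    assume "S' u \<subseteq> S' v"
    moreover have "l u \<in> S' u" by (simp add: S'_def below_def)
    ultimately show "u \<in> below v" using l_S' that by blast
  qed (use C_mono below_mono in \<open>fastforce simp: S'_def\<close>)
  have disj': "S' u \<inter> S' v = {} \<longleftrightarrow> (u, v) \<in> E1" if uv: "u \<in> ?V" "v \<in> ?V" "u \<noteq> v" for u v
  proof
    assume "S' u \<inter> S' v = {}"
    then have "S u \<inter> S v = {}" by (auto simp: S'_def C_def below_def)
    then show "(u, v) \<in> E1" using E1_iff uv by simp
  next
    assume e: "(u, v) \<in> E1"
    have "x \<notin> S' v" if x: "x \<in> S' u" for x
    proof (cases "x \<in> ?W")
      case True
      then have "x \<in> C u" using x lV0 below_V uv by (auto simp: S'_def)
      then have "x \<notin> C v" using disj[OF e] by blast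
      then show ?thesis using True lV0 below_V uv by (auto simp: S'_def)
    next
      case False
      then obtain w where w: "x = l w" "w \<in> below u" using x C_sub uv by (auto simp: S'_def)
      \<comment> \<open>A common leaf \<open>l w\<close> would put the nonempty set
        \<open>C w\<close> inside both \<open>C u\<close> and \<open>C v\<close>.\<close>
      have "C w \<noteq> {}" "C w \<subseteq> C u" using w below_V C_conn conn_nonempty uv C_mono by blast+
      then have "w \<notin> below v" using C_mono[of w v] disj[OF e] by blast
      then show ?thesis using w l_S'[of w v] below_V uv by blast
    qed
    then show "S' u \<inter> S' v = {}" by blast
  qed
  have "subtree T (S' v)" if v: "v \<in> ?V" for v
  proof -
    have "conn (parcs T) (C v)"
      using C_conn[OF v] conn_cong[of "C v" "parcs T" ?F] T_V0 C_sub[OF v] by blast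
    moreover have "\<exists>y\<in>C v. (x, y) \<in> parcs T \<and> (y, x) \<in> parcs T" if x: "x \<in> l ` below v" for x
    proof -
      obtain w where w: "x = l w" "w \<in> below v" using x by blast
      then have "a w \<in> C v" using a below_V v C_mono by blast
      then show ?thesis using w below_V v by (auto simp: T_def)
    qed
    ultimately have "conn (parcs T) (S' v)" unfolding S'_def by (rule conn_attach)
    moreover have "S' v \<subseteq> pverts T" using C_sub below_V v by (fastforce simp: S'_def T_def)
    ultimately show ?thesis using subtree_iff[OF T] by blast
  qed
  moreover have V: "pverts (complement H) = ?V" by (simp add: complement_def)
  moreover have "complement H = overlap_graph ?V S'"
  proof -
    have "(u, v) \<notin> parcs H \<longleftrightarrow> overlap (S' u) (S' v)" if "u \<in> ?V" "v \<in> ?V" "u \<noteq> v" for u v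
    proof -
      \<comment> \<open>Failure to overlap means disjoint, which is \<open>E1\<close>, or nested,
        which is \<open>D\<close> in one of its directions.\<close>
      have "(u, v) \<in> parcs H \<longleftrightarrow> (u, v) \<in> E1 \<or> (u, v) \<in> D \<or> (v, u) \<in> D"
        using E(3) D(1) by blast
      then show ?thesis
        using disj'[OF that] sub'[OF that(1,2)] sub'[OF that(2,1)] that(3)
        by (auto simp: overlap_def below_def)
    qed
    then show ?thesis by (auto simp: complement_def overlap_graph_def)
  qed
  ultimately have rep: "subtree_overlap_representation (complement H) T S'"
    using leaf_tree_is_tree[OF T] unfolding subtree_overlap_representation_def by metis
  have "conn (parcs T) ?W" using b0 conn_cong[of ?W "parcs T" ?F] T_V0 by blast
  then have "subtree T ?W" using subtree_iff[OF T] by (simp add: T_def)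
  moreover have "?W \<inter> S' v \<noteq> {}" if "v \<in> ?V" for v
    using a[OF that] C_sub[OF that] by (auto simp: S'_def)
  ultimately have cov: "covering_subtree T (pverts (complement H)) S' ?W"
    by (simp add: covering_subtree_def V)
  have "leaf T w" if w: "(x, w) \<in> parcs T" "x \<in> ?W" "w \<notin> ?W" for x w
  proof -
    obtain v where v: "v \<in> ?V" "w = l v"
      using w b0(2) lV0 by (auto simp: T_def)
    \<comment> \<open>Old arcs and all anchors stay in \<open>?W\<close>, and leaf names are
      distinct, so only the arc to \<open>a v\<close> starts at \<open>l v\<close>.\<close>
    have "out_arcs (with_proj T) w = {(l v, a v)}"
    proof -
      have "e = (l v, a v)" if e: "e \<in> parcs T" "fst e = l v" for e
      proof -
        have "e \<notin> ?F" using e lV0[OF v(1)] b0(2) by (cases e) auto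
        moreover have "a u \<noteq> l v" if "u \<in> ?V" for u using aW[OF that] lV0[OF v(1)] by metis
        ultimately show ?thesis using e v(1) l(1) by (auto simp: T_def dest: inj_onD)
      qed
      moreover have "(l v, a v) \<in> parcs T" using v by (auto simp: T_def)
      ultimately show ?thesis
        unfolding out_arcs_def with_proj_simps v(2) using fst_conv[of "l v" "a v"] by blast
    qed
    then show ?thesis using v by (simp add: leaf_def out_degree_def T_def)
  qed
  then have bushy: "bushy T ?W" by (auto simp: bushy_def bushy_vertex_def)
  \<comment> \<open>All attached leaves lie outside \<open>?W\<close>, so restricting to
    \<open>?W\<close> gives back \<open>T0\<close>, which is isomorphic to \<open>R\<close>.\<close>
  have "\<lparr>pverts = ?W, parcs = parcs T \<inter> ?W \<times> ?W\<rparr> = T0"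
    using T_V0 b0(2) by (cases T0) auto
  then have "digraph_iso (with_proj T \<restriction> ?W) (with_proj R)"
    using iso by (simp add: restrict_with_proj)
  with rep cov bushy show ?thesis
    unfolding bushy_covered_subtree_overlap_graph_def by blast
qed

theorem theorem1:
  fixes R :: "'r pair_pre_digraph" and G :: "'a pair_pre_digraph"
  assumes "is_tree (with_proj R)" and "pair_graph G"
  shows "(covered_subtree_overlap_graph R G \<longleftrightarrow>
            (\<exists>H. pair_graph H \<and> cochordal_mixed R H \<and> G = complement H)) \<and>
         ((\<exists>H. pair_graph H \<and> cochordal_mixed R H \<and> G = complement H) \<longleftrightarrow>
            bushy_covered_subtree_overlap_graph R G)"
proof -
  \<comment> \<open>The witness is \<open>complement G\<close>, as complementing twice gives
    \<open>G\<close> back.\<close>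
  have "covered_subtree_overlap_graph R G \<Longrightarrow>
      \<exists>H. pair_graph H \<and> cochordal_mixed R H \<and> G = complement H"
    using covered_imp_cochordal_mixed pair_graph_complement complement_complement assms(2) by metis
  moreover have "\<exists>H. pair_graph H \<and> cochordal_mixed R H \<and> G = complement H \<Longrightarrow>
      bushy_covered_subtree_overlap_graph R G"
    using cochordal_mixed_imp_bushy by blast
  moreover have "bushy_covered_subtree_overlap_graph R G \<Longrightarrow> covered_subtree_overlap_graph R G"
    unfolding bushy_covered_subtree_overlap_graph_def covered_subtree_overlap_graph_def by blast
  ultimately show ?thesis by blast
qed

end
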